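(* Let $\Omega$ be a compact and convex domain, let $\mathcal{V}$ be a Banach space with $L^2(\Omega)\subset\mathcal{V}$, and let $\mathcal{P}: L^2(\Omega)\subset\mathcal{V}\to\mathbb{R}\cup\{\infty\}$ be a strongly convex and twice continuously differentiable functional. Let $c>0$ be a modulus of convexity satisfying $\frac12\mathcal{P}''\succ cI$. Then the Bregman distance $D_{\mathcal{P}}$ is bounded below by $$D_{\mathcal{P}}(u,v)\ \ge\ c\,\|u-v\|_{L^2(\Omega)}^2 .$$
   Context: The Bregman distance associated with a convex, Fréchet differentiable functional $\mathcal{P}$ is $D_{\mathcal{P}}(u,v)=\mathcal{P}(u)-\mathcal{P}(v)-\langle\nabla\mathcal{P}(v),u-v\rangle$, where $\nabla\mathcal{P}=\mathcal{P}'$ is the Fréchet derivative. For (bounded linear) operators $A,B$, the notation $A\succ B$ means $\langle h,(A-B)h\rangle\ge 0$ for all $h$; thus $\frac12\mathcal{P}''\succ cI$ means $\frac12\langle\mathcal{P}''(w)h,h\rangle\ge c\|h\|_{L^2(\Omega)}^2$ for all $w,h\in L^2(\Omega)$. The inequality is asserted for all $u,v\in L^2(\Omega)$. *)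

theory Defs
  imports "HOL-Analysis.Analysis" "HOL-Library.Extended_Real"
begin

section \<open>Real \<open>L\<^sup>2\<close> spaces\<close>

definition sq_integrable :: "('a::euclidean_space \<Rightarrow> real) \<Rightarrow> bool" where
  "sq_integrable f \<longleftrightarrow> f \<in> borel_measurable lebesgue \<and> integrable lebesgue (\<lambda>x. (f x)\<^sup>2)"

lemma sq_integrable_mult:
  assumes "sq_integrable f" "sq_integrable g"
  shows "integrable lebesgue (\<lambda>x. f x * g x)"
proof (rule Bochner_Integration.integrable_bound[of _ "\<lambda>x. (f x)\<^sup>2 + (g x)\<^sup>2"])
  show "integrable lebesgue (\<lambda>x. (f x)\<^sup>2 + (g x)\<^sup>2)"
    using assms by (simp add: sq_integrable_def)
  show "(\<lambda>x. f x * g x) \<in> borel_measurable lebesgue"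
    using assms unfolding sq_integrable_def by (intro borel_measurable_times) auto
  have "\<bar>a * b\<bar> \<le> a\<^sup>2 + b\<^sup>2" for a b :: real
  proof -
    have "0 \<le> (\<bar>a\<bar> - \<bar>b\<bar>)\<^sup>2" by simp
    then have "2 * (\<bar>a\<bar> * \<bar>b\<bar>) \<le> a\<^sup>2 + b\<^sup>2"
      by (simp add: power2_diff)
    moreover have "0 \<le> \<bar>a\<bar> * \<bar>b\<bar>" by simp
    ultimately show ?thesis unfolding abs_mult by linarith
  qed
  then show "AE x in lebesgue. norm (f x * g x) \<le> norm ((f x)\<^sup>2 + (g x)\<^sup>2)"
    by simp
qed

lemma sq_integrable_0: "sq_integrable (\<lambda>x. 0)"
  by (simp add: sq_integrable_def)

lemma sq_integrable_scale: "sq_integrable f \<Longrightarrow> sq_integrable (\<lambda>x. c * f x)"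
  unfolding sq_integrable_def
  by (auto simp: power_mult_distrib intro!: borel_measurable_times)

lemma sq_integrable_add:
  assumes "sq_integrable f" "sq_integrable g"
  shows "sq_integrable (\<lambda>x. f x + g x)"
proof -
  have "integrable lebesgue (\<lambda>x. (f x)\<^sup>2 + (g x)\<^sup>2 + 2 * (f x * g x))"
    using assms sq_integrable_mult[OF assms] by (simp add: sq_integrable_def)
  then have "integrable lebesgue (\<lambda>x. (f x + g x)\<^sup>2)"
    by (simp add: power2_sum mult.assoc)
  moreover have "(\<lambda>x. f x + g x) \<in> borel_measurable lebesgue"
    using assms unfolding sq_integrable_def by (intro borel_measurable_add) auto
  ultimately show ?thesis by (simp add: sq_integrable_def)
qed

lemma sq_integrable_uminus: "sq_integrable f \<Longrightarrow> sq_integrable (\<lambda>x. - f x)"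
  using sq_integrable_scale[of f "-1"] by simp

lemma sq_integrable_diff:
  "sq_integrable f \<Longrightarrow> sq_integrable g \<Longrightarrow> sq_integrable (\<lambda>x. f x - g x)"
  using sq_integrable_add[OF _ sq_integrable_uminus, of f g] by simp

definition L2_rel :: "('a::euclidean_space \<Rightarrow> real) \<Rightarrow> ('a \<Rightarrow> real) \<Rightarrow> bool" where
  "L2_rel f g \<longleftrightarrow> sq_integrable f \<and> sq_integrable g \<and> (AE x in lebesgue. f x = g x)"

lemma L2_rel_part_equivp: "part_equivp L2_rel"
proof (rule part_equivpI)
  show "\<exists>f. L2_rel f f"
    using sq_integrable_0 by (auto simp: L2_rel_def)
  show "symp L2_rel"
    by (auto simp: symp_def L2_rel_def eq_commute)
  show "transp L2_rel"
    by (auto simp: transp_def L2_rel_def)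
qed

text \<open>\<open>L\<^sup>2(\<real>\<^sup>n)\<close>: square-integrable functions modulo equality almost everywhere.\<close>

quotient_type (overloaded) 'a L2 = "'a::euclidean_space \<Rightarrow> real" / partial: L2_rel
  by (rule L2_rel_part_equivp)

instantiation L2 :: (euclidean_space) real_vector
begin

lift_definition zero_L2 :: "'a L2" is "\<lambda>x. 0"
  by (simp add: L2_rel_def sq_integrable_0)

lift_definition plus_L2 :: "'a L2 \<Rightarrow> 'a L2 \<Rightarrow> 'a L2" is "\<lambda>f g x. f x + g x"
  by (auto simp: L2_rel_def intro: sq_integrable_add)

lift_definition minus_L2 :: "'a L2 \<Rightarrow> 'a L2 \<Rightarrow> 'a L2" is "\<lambda>f g x. f x - g x"
  by (auto simp: L2_rel_def intro: sq_integrable_diff)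

lift_definition uminus_L2 :: "'a L2 \<Rightarrow> 'a L2" is "\<lambda>f x. - f x"
  by (auto simp: L2_rel_def intro: sq_integrable_uminus)

lift_definition scaleR_L2 :: "real \<Rightarrow> 'a L2 \<Rightarrow> 'a L2" is "\<lambda>c f x. c * f x"
  by (auto simp: L2_rel_def intro: sq_integrable_scale)

instance
proof
  fix a b :: real and u v w :: "'a L2"
  show "u + v + w = u + (v + w)"
    by transfer (auto simp: L2_rel_def add.assoc intro!: sq_integrable_add)
  show "u + v = v + u"
    by transfer (auto simp: L2_rel_def add.commute intro!: sq_integrable_add)
  show "0 + u = u"
    by transfer (auto simp: L2_rel_def)
  show "- u + u = 0"
    by transfer (auto simp: L2_rel_def sq_integrable_0)
  show "u - v = u + - v"
    by transfer (auto simp: L2_rel_def intro!: sq_integrable_diff)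
  show "a *\<^sub>R (u + v) = a *\<^sub>R u + a *\<^sub>R v"
    by transfer (auto simp: L2_rel_def distrib_left intro!: sq_integrable_add sq_integrable_scale)
  show "(a + b) *\<^sub>R u = a *\<^sub>R u + b *\<^sub>R u"
    by transfer (auto simp: L2_rel_def distrib_right intro!: sq_integrable_add sq_integrable_scale)
  show "a *\<^sub>R b *\<^sub>R u = (a * b) *\<^sub>R u"
    by transfer (auto simp: L2_rel_def mult.assoc intro!: sq_integrable_scale)
  show "1 *\<^sub>R u = u"
    by transfer (auto simp: L2_rel_def)
qed

end

instantiation L2 :: (euclidean_space) real_inner
begin

lift_definition inner_L2 :: "'a L2 \<Rightarrow> 'a L2 \<Rightarrow> real" is
  "\<lambda>f g. \<integral>x. f x * g x \<partial>lebesgue"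
proof -
  fix f f' g g' :: "'a \<Rightarrow> real"
  assume "L2_rel f f'" "L2_rel g g'"
  then have "AE x in lebesgue. f x * g x = f' x * g' x"
    and "integrable lebesgue (\<lambda>x. f x * g x)" "integrable lebesgue (\<lambda>x. f' x * g' x)"
    by (auto simp: L2_rel_def intro: sq_integrable_mult)
  then show "(\<integral>x. f x * g x \<partial>lebesgue) = (\<integral>x. f' x * g' x \<partial>lebesgue)"
    by (intro integral_cong_AE borel_measurable_integrable)
qed

definition norm_L2 :: "'a L2 \<Rightarrow> real" where "norm_L2 u = sqrt (inner u u)"
definition sgn_L2 :: "'a L2 \<Rightarrow> 'a L2" where "sgn_L2 u = u /\<^sub>R norm u"
definition dist_L2 :: "'a L2 \<Rightarrow> 'a L2 \<Rightarrow> real" where "dist_L2 u v = norm (u - v)"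
definition uniformity_L2 :: "('a L2 \<times> 'a L2) filter" where
  "uniformity_L2 = (INF e\<in>{0<..}. principal {(x, y). dist x y < e})"
definition open_L2 :: "'a L2 set \<Rightarrow> bool" where
  "open_L2 U \<longleftrightarrow> (\<forall>x\<in>U. \<forall>\<^sub>F (x', y) in uniformity. x' = x \<longrightarrow> y \<in> U)"

instance
proof
  fix a :: real and u v w :: "'a L2" and U :: "'a L2 set"
  show "dist u v = norm (u - v)"
    by (rule dist_L2_def)
  show "sgn u = u /\<^sub>R norm u"
    by (rule sgn_L2_def)
  show "uniformity = (INF e\<in>{0<..}. principal {(x, y :: 'a L2). dist x y < e})"
    by (rule uniformity_L2_def)
  show "open U \<longleftrightarrow> (\<forall>x\<in>U. \<forall>\<^sub>F (x', y) in uniformity. x' = x \<longrightarrow> y \<in> U)"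
    by (rule open_L2_def)
  show "inner u v = inner v u"
    by transfer (simp add: mult.commute)
  show "inner (u + v) w = inner u w + inner v w"
    by transfer (simp add: L2_rel_def distrib_right sq_integrable_mult)
  show "inner (a *\<^sub>R u) v = a * inner u v"
    by transfer (simp add: mult.assoc)
  show "0 \<le> inner u u"
    by transfer simp
  show "inner u u = 0 \<longleftrightarrow> u = 0"
  proof transfer
    fix f :: "'a \<Rightarrow> real"
    assume "L2_rel f f"
    then have f: "sq_integrable f" by (simp add: L2_rel_def)
    have "(\<integral>x. f x * f x \<partial>lebesgue) = 0 \<longleftrightarrow> (AE x in lebesgue. f x * f x = 0)"
      by (rule integral_nonneg_eq_0_iff_AE) (auto intro: sq_integrable_mult f)
    also have "\<dots> \<longleftrightarrow> L2_rel f (\<lambda>x. 0)"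
      using f by (simp add: L2_rel_def sq_integrable_0)
    finally show "(\<integral>x. f x * f x \<partial>lebesgue) = 0 \<longleftrightarrow> L2_rel f (\<lambda>x. 0)" .
  qed
  show "norm u = sqrt (inner u u)"
    by (rule norm_L2_def)
qed

end

text \<open>
  \<open>L\<^sup>2(\<Omega>)\<close> is identified, via extension by zero, with the subspace of those classes in
  \<open>L\<^sup>2(\<real>\<^sup>n)\<close> that vanish almost everywhere off \<open>\<Omega>\<close>; the norm of \<open>L\<^sup>2(\<real>\<^sup>n)\<close> restricts to the
  norm of \<open>L\<^sup>2(\<Omega>)\<close> (lemma \<open>norm_L2_on\<close>).
\<close>

lift_definition vanishes_off :: "'a::euclidean_space set \<Rightarrow> 'a L2 \<Rightarrow> bool" is
  "\<lambda>\<Omega> f. AE x in lebesgue. x \<notin> \<Omega> \<longrightarrow> f x = 0"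
proof -
  fix \<Omega> :: "'a set" and f g :: "'a \<Rightarrow> real"
  assume "L2_rel f g"
  then have "AE x in lebesgue. f x = g x" by (simp add: L2_rel_def)
  then have "AE x in lebesgue. (x \<notin> \<Omega> \<longrightarrow> f x = 0) \<longleftrightarrow> (x \<notin> \<Omega> \<longrightarrow> g x = 0)"
    by (rule eventually_mono) simp
  then show "(AE x in lebesgue. x \<notin> \<Omega> \<longrightarrow> f x = 0) = (AE x in lebesgue. x \<notin> \<Omega> \<longrightarrow> g x = 0)"
    by (rule eventually_subst)
qed

definition L2_on :: "'a::euclidean_space set \<Rightarrow> 'a L2 set" where
  "L2_on \<Omega> = {u. vanishes_off \<Omega> u}"

lemma subspace_L2_on: "subspace (L2_on \<Omega>)"
proof -
  have "vanishes_off \<Omega> 0"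
    by transfer simp
  moreover have "vanishes_off \<Omega> (u + v)" if "vanishes_off \<Omega> u" "vanishes_off \<Omega> v" for u v
    using that by transfer auto
  moreover have "vanishes_off \<Omega> (c *\<^sub>R u)" if "vanishes_off \<Omega> u" for c u
    using that by transfer auto
  ultimately show ?thesis
    by (auto simp: subspace_def L2_on_def)
qed

lemma norm_L2_on:
  assumes "u \<in> L2_on \<Omega>" "\<Omega> \<in> sets lebesgue"
  shows "(norm u)\<^sup>2 = (LINT x:\<Omega>|lebesgue. (rep_L2 u x)\<^sup>2)"
proof -
  have v: "AE x in lebesgue. x \<notin> \<Omega> \<longrightarrow> rep_L2 u x = 0"
    using assms(1) by (simp add: L2_on_def vanishes_off_def)
  have "L2_rel (rep_L2 u) (rep_L2 u)"
    by (rule Quotient3_rep_reflp[OF Quotient3_L2])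
  then have r: "sq_integrable (rep_L2 u)"
    by (simp add: L2_rel_def)
  have "(\<integral>x. rep_L2 u x * rep_L2 u x \<partial>lebesgue)
      = (\<integral>x. indicator \<Omega> x *\<^sub>R (rep_L2 u x)\<^sup>2 \<partial>lebesgue)"
  proof (rule integral_cong_AE)
    show "(\<lambda>x. rep_L2 u x * rep_L2 u x) \<in> borel_measurable lebesgue"
      by (rule borel_measurable_integrable[OF sq_integrable_mult[OF r r]])
    have "integrable lebesgue (\<lambda>x. (rep_L2 u x)\<^sup>2)"
      using r unfolding sq_integrable_def by (rule conjunct2)
    then have "integrable lebesgue (\<lambda>x. indicator \<Omega> x *\<^sub>R (rep_L2 u x)\<^sup>2)"
      by (rule integrable_mult_indicator[OF assms(2)])
    then show "(\<lambda>x. indicator \<Omega> x *\<^sub>R (rep_L2 u x)\<^sup>2) \<in> borel_measurable lebesgue"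
      by (rule borel_measurable_integrable)
    show "AE x in lebesgue. rep_L2 u x * rep_L2 u x = indicator \<Omega> x *\<^sub>R (rep_L2 u x)\<^sup>2"
      using v by (rule eventually_mono) (auto simp: power2_eq_square indicator_def)
  qed
  moreover have "(norm u)\<^sup>2 = (\<integral>x. rep_L2 u x * rep_L2 u x \<partial>lebesgue)"
    unfolding power2_norm_eq_inner by (simp add: inner_L2_def)
  ultimately show ?thesis
    by (simp add: set_lebesgue_integral_def)
qed

lemma abs_L2_in_L2_on:
  assumes "sq_integrable f" "\<And>x. x \<notin> \<Omega> \<Longrightarrow> f x = 0"
  shows "abs_L2 f \<in> L2_on \<Omega>"
proof -
  have "L2_rel f f" using assms(1) by (simp add: L2_rel_def)
  then have "vanishes_off \<Omega> (abs_L2 f) \<longleftrightarrow> (AE x in lebesgue. x \<notin> \<Omega> \<longrightarrow> f x = 0)"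
    by (rule vanishes_off.abs_eq)
  with assms(2) show ?thesis by (simp add: L2_on_def)
qed


section \<open>Functionals with values in \<open>\<real> \<union> {\<infinity>}\<close>\<close>

definition strongly_convex_on :: "'b::real_normed_vector set \<Rightarrow> ('b \<Rightarrow> ereal) \<Rightarrow> bool" where
  "strongly_convex_on S F \<longleftrightarrow> convex S \<and>
     (\<exists>m>0. \<forall>u\<in>S. \<forall>v\<in>S. \<forall>t\<in>{0<..<1}.
        F (t *\<^sub>R u + (1 - t) *\<^sub>R v) + ereal (m * t * (1 - t) * (norm (u - v))\<^sup>2)
          \<le> ereal t * F u + ereal (1 - t) * F v)"

text \<open>
  \<open>F\<close> is finite on the linear subspace \<open>S\<close> and \<open>C\<^sup>2\<close> there in the sense of Frechet, with first
  and second derivatives \<open>F'\<close> and \<open>F''\<close>. Derivatives are taken within \<open>S\<close>, so \<open>F' u\<close> and \<open>F'' u\<close>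
  are determined only along directions in \<open>S\<close>. For \<open>S = L2_on \<Omega>\<close>, derivatives defined on the
  subspace alone extend to the whole type, with the same norms, by precomposition with
  multiplication by the indicator of \<open>\<Omega>\<close>.
\<close>

definition C2_derivs_on ::
  "'b::real_normed_vector set \<Rightarrow> ('b \<Rightarrow> ereal) \<Rightarrow> ('b \<Rightarrow> 'b \<Rightarrow>\<^sub>L real) \<Rightarrow>
     ('b \<Rightarrow> 'b \<Rightarrow>\<^sub>L 'b \<Rightarrow>\<^sub>L real) \<Rightarrow> bool" where
  "C2_derivs_on S F F' F'' \<longleftrightarrow>
     (\<forall>u\<in>S. \<bar>F u\<bar> \<noteq> \<infinity>) \<and>
     (\<forall>u\<in>S. ((\<lambda>w. real_of_ereal (F w)) has_derivative blinfun_apply (F' u)) (at u within S)) \<and>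
     (\<forall>u\<in>S. (F' has_derivative blinfun_apply (F'' u)) (at u within S)) \<and>
     continuous_on S F''"

text \<open>The Bregman distance of \<open>F\<close>, where \<open>F'\<close> is the Fr\'echet derivative of \<open>F\<close>.\<close>

definition bregman_distance ::
  "('b::real_normed_vector \<Rightarrow> ereal) \<Rightarrow> ('b \<Rightarrow> 'b \<Rightarrow>\<^sub>L real) \<Rightarrow> 'b \<Rightarrow> 'b \<Rightarrow> ereal" where
  "bregman_distance F F' u v = F u - F v - ereal (blinfun_apply (F' v) (u - v))"

end

theory Submission imports Defs begin

text \<open>
  Restricted to the line through \<open>v\<close> and \<open>u\<close>, the functional is twice differentiable, and its
  Bregman distance is the second-order Taylor remainder at \<open>v\<close>. In Lagrange form this remainder is
  half the Hessian at an intermediate point, evaluated at \<open>u - v\<close>.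
\<close>

lemma bregman_distance_ge_if_hessian_ge:
  fixes S :: "'b::real_normed_vector set"
  assumes S: "subspace S" and C2: "C2_derivs_on S F F' F''"
    and hess: "\<And>w h. w \<in> S \<Longrightarrow> h \<in> S \<Longrightarrow> 1 / 2 * F'' w h h \<ge> c * (norm h)\<^sup>2"
    and u: "u \<in> S" and v: "v \<in> S"
  shows "bregman_distance F F' u v \<ge> ereal (c * (norm (u - v))\<^sup>2)"
proof -
  define h where "h = u - v"
  have h: "h \<in> S"
    unfolding h_def using S u v by (rule subspace_diff)
  \<comment> \<open>The parameter ranges over all reals, so derivatives within \<open>S\<close> will
    pull back to unrestricted derivatives in \<open>t\<close>, even at 0 and 1.\<close>
  have line: "v + t *\<^sub>R h \<in> S" for t
    using S v h by (simp add: subspace_add subspace_mul)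
  have line_deriv: "((\<lambda>t. v + t *\<^sub>R h) has_derivative (\<lambda>s. s *\<^sub>R h)) (at t)" for t
    by (auto intro!: derivative_eq_intros)
  \<comment> \<open>Chain rule: since the line stays in \<open>S\<close>, the derivative within
    \<open>S\<close> restricts to one within the image of the line.\<close>
  have compose_line: "((\<lambda>t. f (v + t *\<^sub>R h)) has_derivative (\<lambda>s. f' (s *\<^sub>R h))) (at t)"
    if "(f has_derivative f') (at (v + t *\<^sub>R h) within S)"
    for f :: "'b \<Rightarrow> 'c::real_normed_vector" and f' t
    using has_derivative_in_compose[OF line_deriv has_derivative_subset[OF that]] line by auto
  define g where "g = (\<lambda>t. real_of_ereal (F (v + t *\<^sub>R h)))"
  define g' where "g' = (\<lambda>t. F' (v + t *\<^sub>R h) h)"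
  define g'' where "g'' = (\<lambda>t. F'' (v + t *\<^sub>R h) h h)"
  have g: "DERIV g t :> g' t" for t
  proof -
    have "((\<lambda>w. real_of_ereal (F w)) has_derivative F' (v + t *\<^sub>R h)) (at (v + t *\<^sub>R h) within S)"
      using C2 line unfolding C2_derivs_on_def by blast
    from compose_line[OF this] show ?thesis
      by (simp add: g_def g'_def has_field_derivative_def blinfun.scaleR_right mult_commute_abs)
  qed
  have g': "DERIV g' t :> g'' t" for t
  proof -
    have "(F' has_derivative F'' (v + t *\<^sub>R h)) (at (v + t *\<^sub>R h) within S)"
      using C2 line unfolding C2_derivs_on_def by blast
    \<comment> \<open>Evaluation at the fixed vector \<open>h\<close> is bounded linear on
      functionals, so it commutes with differentiating \<open>F'\<close> along the line.\<close>
    from bounded_linear.has_derivative[OF blinfun.bounded_linear_left compose_line[OF this]]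
    show ?thesis
      by (simp add: g'_def g''_def has_field_derivative_def blinfun.scaleR_right
          blinfun.scaleR_left mult_commute_abs)
  qed
  \<comment> \<open>The derivatives as a sequence, as \<open>Maclaurin\<close> expects; at order 2
    only indices 0, 1 and 2 occur, so the value beyond is arbitrary.\<close>
  define d where "d = (\<lambda>m::nat. if m = 0 then g else if m = 1 then g' else g'')"
  have "\<forall>m t. m < 2 \<and> 0 \<le> t \<and> t \<le> 1 \<longrightarrow> DERIV (d m) t :> d (Suc m) t"
    using g g' by (auto simp: d_def less_2_cases_iff)
  \<comment> \<open>Expansion from 0 (the point \<open>v\<close>) to 1 (the point \<open>u\<close>);
    the 2 in the remainder is 2!.\<close>
  from Maclaurin[of 1 2 d g, OF _ _ _ this] obtain t where "g 1 = g 0 + g' 0 + g'' t / 2"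
    by (auto simp: d_def numeral_2_eq_2)
  moreover have "g'' t / 2 \<ge> c * (norm h)\<^sup>2"
    using hess[OF line h, of t] by (simp add: g''_def)
  ultimately have "real_of_ereal (F u) - real_of_ereal (F v) - F' v h \<ge> c * (norm h)\<^sup>2"
    by (simp add: g_def g'_def h_def)
  \<comment> \<open>Finiteness makes the \<open>ereal\<close> differences in the Bregman distance
    agree with the real ones.\<close>
  moreover have "\<bar>F u\<bar> \<noteq> \<infinity>" "\<bar>F v\<bar> \<noteq> \<infinity>"
    using C2 u v by (auto simp: C2_derivs_on_def)
  ultimately show ?thesis
    by (auto simp: bregman_distance_def h_def)
qed

text \<open>The injection \<open>\<iota>\<close> models the inclusion of the \<open>L2\<close> space
  in the Banach space; derivatives and norms are those of the pullback of \<open>P\<close> to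
  \<open>L2_on \<Omega>\<close>, a subspace to which the bound above applies.\<close>

theorem proposition2p6:
  fixes \<Omega> :: "'a::euclidean_space set"
    and \<iota> :: "'a L2 \<Rightarrow> 'v::banach"
    and P :: "'v \<Rightarrow> ereal"
    and P' :: "'a L2 \<Rightarrow> 'a L2 \<Rightarrow>\<^sub>L real"
    and P'' :: "'a L2 \<Rightarrow> 'a L2 \<Rightarrow>\<^sub>L 'a L2 \<Rightarrow>\<^sub>L real"
    and c :: real
  assumes "compact \<Omega>" and "convex \<Omega>" and "\<Omega> \<noteq> {}"
    and "linear \<iota>" and "inj_on \<iota> (L2_on \<Omega>)"
    and "\<forall>u\<in>L2_on \<Omega>. P (\<iota> u) \<noteq> -\<infinity>"
    and "strongly_convex_on (L2_on \<Omega>) (\<lambda>u. P (\<iota> u))"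
    and "C2_derivs_on (L2_on \<Omega>) (\<lambda>u. P (\<iota> u)) P' P''"
    and "c > 0"
    and "\<forall>w\<in>L2_on \<Omega>. \<forall>h\<in>L2_on \<Omega>.
           1 / 2 * blinfun_apply (blinfun_apply (P'' w) h) h \<ge> c * (norm h)\<^sup>2"
  shows "\<forall>u\<in>L2_on \<Omega>. \<forall>v\<in>L2_on \<Omega>.
           bregman_distance (\<lambda>u. P (\<iota> u)) P' u v \<ge> ereal (c * (norm (u - v))\<^sup>2)"
  using bregman_distance_ge_if_hessian_ge[OF subspace_L2_on assms(8)] assms(10) by blast

end
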